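(* Consider the vector plant $\dot x(t)=Ax(t)+Bu(t)$, $x(t)\in\mathbb{R}^n$, $u(t)\in\mathbb{R}^m$, $\|x(0)\|<L$, in closed loop with a sensor, finite-rate communication channels with bounded delay, and a controller, as described in the context. Let $z(t)=x(t)-\hat x(t)$ be the state estimation error, let $b_c(t)$ be the amount of information (in bits) received by the controller up to time $t$, and let $\sigma>0$. Then the following necessary conditions hold. (i) If the state estimation error satisfies $\|z(t)\|\le\|z(0)\|\,e^{-\sigma t}$, then $$b_c(t)\ \ge\ t\,\frac{\operatorname{Tr}(A)+n\sigma}{\ln2}+n\log\frac{L}{\|z(0)\|}.$$ (ii) If the system is stabilizable and $\|x(t)\|\le\|x(0)\|\,e^{-\sigma t}$, then $$b_c(t)\ \ge\ t\,\frac{\operatorname{Tr}(A)+n\sigma}{\ln2}.$$ In both cases, the information access rate $R_c=\limsup_{t\to\infty}b_c(t)/t$ satisfies $$R_c\ \ge\ \frac{\operatorname{Tr}(A)+n\sigma}{\ln 2}.$$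
   Context: $\log$ is the logarithm to base $2$, $\ln$ the natural logarithm, $\|\cdot\|$ the Euclidean norm. Model. $A$ is a real $n\times n$ matrix all of whose eigenvalues are real and positive, assumed equal to its real Jordan form; $B$ is a real $n\times m$ matrix. The initial condition is arbitrary with $\|x(0)\|<L$, $L$ known to sensor and controller. The sensor measures $x(t)$ exactly; the controller applies $u(t)$ with infinite precision and without delay. Sensor and controller communicate only through channels (one per coordinate): at times chosen by the sensor, packets with finitely many bits are sent, and each is received without error after an unknown delay in $[0,\gamma]$. The controller chooses $u$ and maintains a state estimate $\hat x(t)$ (with $z(0)=x(0)-\hat x(0)$) only on the basis of the information received so far. The rule by which the sensor decides when and what to transmit is arbitrary. $b_c(t)$ denotes the amount of information, measured in bits, conveyed by both the data payload of the packets and the timing of their reception, that the controller has received up to time $t$. That is, on the basis of $b_c(t)$ bits the controller can distinguish at most $2^{b_c(t)}$ alternatives, so at most $2^{b_c(t)}$ different control trajectories on $[0,t]$ and estimates $\hat x(t)$ can arise as $x(0)$ ranges over the admissible initial conditions; in particular the uncertainty set of possible states $x(t)$ has to be covered by at most $2^{b_c(t)}$ balls of the required accuracy. In (i), $\|z(0)\|$ is regarded as a given positive number, so that the required accuracy at time $t$ is $\|z(0)\|e^{-\sigma t}$. *)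

theory Defs
  imports "HOL-Analysis.Analysis" "Jordan_Normal_Form.Jordan_Normal_Form"
begin

no_notation Matrix.vec_index (infixl "$" 100)

definition complex_eigenvalue :: "real ^ 'n ^ 'n \<Rightarrow> complex \<Rightarrow> bool" where
  "complex_eigenvalue A l \<longleftrightarrow>
     (\<exists>v :: complex ^ 'n. v \<noteq> 0 \<and> (\<chi> i j. complex_of_real (A $ i $ j)) *v v = l *s v)"

(* A finite index type carries no order, so an enumeration idx of it says which coordinate
   comes first.  When all eigenvalues are real, the real Jordan form has no rotation blocks
   and is an ordinary Jordan matrix over the reals. *)
definition in_real_jordan_form :: "real ^ 'n ^ 'n \<Rightarrow> bool" where
  "in_real_jordan_form A \<longleftrightarrow>
     (\<exists>(idx :: 'n \<Rightarrow> nat) (blocks :: (nat \<times> real) list).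
        bij_betw idx UNIV {..<CARD('n)} \<and>
        0 \<notin> fst ` set blocks \<and> sum_list (map fst blocks) = CARD('n) \<and>
        (\<forall>i j. A $ i $ j = jordan_matrix blocks $$ (idx i, idx j)))"

definition stabilizable :: "real ^ 'n ^ 'n \<Rightarrow> real ^ 'm ^ 'n \<Rightarrow> bool" where
  "stabilizable A B \<longleftrightarrow>
     (\<exists>K :: real ^ 'n ^ 'm. \<forall>l. complex_eigenvalue (A + B ** K) l \<longrightarrow> Re l < 0)"

(* Caratheodory solutions on [0, \<infinity>), in integral form: the input jumps when packets arrive,
   so the differential equation cannot be required at every time. *)
definition plant_trajectory ::
  "real ^ 'n ^ 'n \<Rightarrow> real ^ 'm ^ 'n \<Rightarrow> (real \<Rightarrow> real ^ 'm) \<Rightarrow> real ^ 'n \<Rightarrow> (real \<Rightarrow> real ^ 'n) \<Rightarrow> bool"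
  where
  "plant_trajectory A B u x0 x \<longleftrightarrow>
     x 0 = x0 \<and>
     (\<forall>t\<ge>0. ((\<lambda>s. A *v x s + B *v u s) has_integral (x t - x0)) {0..t})"

record packet =
  sent :: real
  payload :: "bool list"
  delay :: real

definition arrival :: "packet \<Rightarrow> real" where
  "arrival p = sent p + delay p"

record ('n::finite, 'm::finite) run =
  packets :: "'n \<Rightarrow> packet set"
  control :: "real \<Rightarrow> real ^ 'm"
  estimate :: "real \<Rightarrow> real ^ 'n"
  state :: "real \<Rightarrow> real ^ 'n"

(* Channel, payload and reception time; sending times and delays are not observed. *)
definition received :: "('n::finite, 'm::finite) run \<Rightarrow> real \<Rightarrow> ('n \<times> bool list \<times> real) set" where
  "received r t = {(i, payload p, arrival p) | i p. p \<in> packets r i \<and> arrival p \<le> t}"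

(* A closed loop is given by the run resulting from each initial condition, for an arbitrary
   realization of the delays.  The sensor measures x exactly from time 0 on, hence knows x(0);
   therefore an arbitrary transmission rule is an arbitrary dependence of the packets on x(0).
   The controller is a pair of maps from the reception history to the current input and the
   current estimate. *)
definition closed_loop ::
  "real ^ 'n ^ 'n \<Rightarrow> real ^ 'm ^ 'n \<Rightarrow> real \<Rightarrow> real \<Rightarrow>
    (real ^ 'n \<Rightarrow> ('n::finite, 'm::finite) run) \<Rightarrow> bool" where
  "closed_loop A B L \<gamma> R \<longleftrightarrow>
     (\<forall>x0 \<in> ball 0 L. \<forall>i. \<forall>p \<in> packets (R x0) i. 0 \<le> sent p \<and> delay p \<in> {0..\<gamma>}) \<and>
     (\<forall>x0 \<in> ball 0 L. \<forall>i t. finite {p \<in> packets (R x0) i. sent p \<le> t}) \<and>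
     (\<exists>\<kappa> \<epsilon>. \<forall>x0 \<in> ball 0 L. \<forall>t\<ge>0.
        control (R x0) t = \<kappa> t (received (R x0) t) \<and>
        estimate (R x0) t = \<epsilon> t (received (R x0) t)) \<and>
     (\<forall>x0 \<in> ball 0 L. plant_trajectory A B (control (R x0)) x0 (state (R x0)))"

definition estimation_error :: "('n::finite, 'm::finite) run \<Rightarrow> real \<Rightarrow> real ^ 'n" where
  "estimation_error r t = state r t - estimate r t"

definition alternatives ::
  "real \<Rightarrow> (real ^ 'n \<Rightarrow> ('n::finite, 'm::finite) run) \<Rightarrow> real \<Rightarrow> ((real \<Rightarrow> real ^ 'm) \<times> (real ^ 'n)) set" where
  "alternatives L R t =
     (\<lambda>x0. (restrict (control (R x0)) {0..t}, estimate (R x0) t)) ` ball 0 L"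

(* The value \<infinity> is allowed, because real-valued reception times can in principle convey
   infinitely many bits; it imposes no restriction on the alternatives. *)
definition received_bits ::
  "real \<Rightarrow> (real ^ 'n \<Rightarrow> ('n::finite, 'm::finite) run) \<Rightarrow> (real \<Rightarrow> ereal) \<Rightarrow> bool" where
  "received_bits L R b \<longleftrightarrow>
     (\<forall>t\<ge>0. 0 \<le> b t \<and>
        (b t < \<infinity> \<longrightarrow>
           finite (alternatives L R t) \<and>
           real (card (alternatives L R t)) \<le> 2 powr real_of_ereal (b t)))"

definition information_access_rate :: "(real \<Rightarrow> ereal) \<Rightarrow> ereal" where
  "information_access_rate b = Limsup at_top (\<lambda>t. b t / ereal t)"

end

(* Fix t and sort the initial conditions by the alternative that the controller sees up to
   time t.  Two trajectories with the same control differ by a solution of the homogeneous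
   equation y' = A y, so all initial conditions of one class lie in a translate of the image
   under exp(-t A) of a ball whose radius r is the required accuracy.  These images cover the
   ball of radius L and each has det(exp(-t A)) = exp(-t Tr A) times the volume of its ball,
   hence L^n <= 2^b(t) * exp(-t Tr A) * r^n.  Now take logarithms with
   r = z0 * exp(-sigma t).  The determinant comes from the triangular shape of the Jordan form. *)

theory Submission
  imports Defs
begin

section \<open>Triangular determinants and volumes of linear images\<close>

lemma det_triangular:
  fixes M :: "'a::comm_ring_1^'n^'n" and idx :: "'n::finite \<Rightarrow> nat"
  assumes inj: "inj idx" and tri: "\<And>i j. idx j < idx i \<Longrightarrow> M $ i $ j = 0"
  shows "Determinants.det M = (\<Prod>i\<in>UNIV. M $ i $ i)"
proof -
  have vanish: "(\<Prod>i\<in>UNIV. M $ i $ p i) = 0" if p: "p permutes UNIV" and "p \<noteq> id" for p :: "'n \<Rightarrow> 'n"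
  proof -
    \<comment> \<open>If \<open>p\<close> never lowered \<open>idx\<close>, then, since permuting
      leaves the sum of \<open>idx\<close> unchanged, \<open>idx\<close> would be preserved at every
      index, and injectivity would force \<open>p = id\<close>. An index that is lowered picks out a
      zero entry.\<close>
    have "\<exists>i. idx (p i) < idx i"
    proof (rule ccontr)
      assume "\<not> ?thesis"
      then have le: "\<And>i. idx i \<le> idx (p i)" by (simp add: not_less)
      have "sum idx UNIV = (\<Sum>i\<in>UNIV. idx (p i))"
        using sum.permute[OF p, of idx] by (simp only: o_def)
      then have "\<And>i. idx i = idx (p i)"
        using le by (rule sum_mono_inv[where I = UNIV]) auto
      then show False using inj \<open>p \<noteq> id\<close> by (metis eq_id_iff injD)
    qed
    then show ?thesis
      by (intro prod_zero) (auto intro: tri)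
  qed
  have "Determinants.det M = (\<Sum>p\<in>{id}. of_int (sign p) * (\<Prod>i\<in>UNIV. M $ i $ p i))"
    unfolding Determinants.det_def
    by (rule sum.mono_neutral_right) (auto simp: vanish finite_permutations permutes_id)
  then show ?thesis by simp
qed

lemma det_matrix_shear:
  fixes m n :: "'n::finite"
  assumes "m \<noteq> n"
  shows "Determinants.det (matrix (\<lambda>v::real^'n. \<chi> i. if i = m then v$m + v$n else v$i)) = 1"
proof -
  have "matrix (\<lambda>v::real^'n. \<chi> i. if i = m then v$m + v$n else v$i)
     = (\<chi> k. if k = m
          then Finite_Cartesian_Product.row m (Finite_Cartesian_Product.mat 1)
            + 1 *s Finite_Cartesian_Product.row n (Finite_Cartesian_Product.mat 1)
          else Finite_Cartesian_Product.row k (Finite_Cartesian_Product.mat 1))"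
    unfolding Finite_Cartesian_Product.vec_eq_iff
    by (simp add: matrix_def Finite_Cartesian_Product.row_def Finite_Cartesian_Product.mat_def axis_def)
  then show ?thesis
    using det_row_operation[OF assms, of "Finite_Cartesian_Product.mat 1::real^'n^'n" 1] by simp
qed

text \<open>The library version of this fact requires a well-ordered index type; the order only enters
  through the determinant of a shear.\<close>

lemma measure_linear_image_finite:
  fixes f :: "real^'n \<Rightarrow> real^'n"
  assumes "linear f" and "S \<in> lmeasurable"
  shows "f ` S \<in> lmeasurable \<and>
    measure lebesgue (f ` S) = \<bar>Determinants.det (matrix f)\<bar> * measure lebesgue S"
proof -
  have "\<forall>S\<in>lmeasurable. f ` S \<in> lmeasurable \<and>
      measure lebesgue (f ` S) = \<bar>Determinants.det (matrix f)\<bar> * measure lebesgue S"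
    (is "?P f")
  \<comment> \<open>Every linear map is composed of maps into a coordinate hyperplane, stretches,
    coordinate swaps and shears. Both the volume factor and the absolute determinant are
    multiplicative, so these maps suffice.\<close>
  proof (rule induct_linear_elementary[of f ?P, OF \<open>linear f\<close>])
    fix f g :: "real^'n \<Rightarrow> real^'n"
    assume "linear f" "linear g" "?P f" "?P g"
    then show "?P (f \<circ> g)"
      by (simp only: image_comp[symmetric] matrix_compose Determinants.det_mul abs_mult mult.assoc) simp
  next
    fix f :: "real^'n \<Rightarrow> real^'n" and k
    assume "linear f" and "\<And>x. f x $ k = 0"
    then have "\<not> inj f"
      by (metis linear_injective_imp_surjective one_neq_zero surjE vec_component)
    then have "negligible (f ` S)" for S
      using negligible_linear_singular_image[OF \<open>linear f\<close>] by blast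
    moreover have "Determinants.det (matrix f) = 0"
      using det_nz_iff_inj \<open>linear f\<close> \<open>\<not> inj f\<close> by blast
    ultimately show "?P f"
      by (simp add: negligible_iff_measure)
  next
    fix c :: "'n \<Rightarrow> real"
    show "?P (\<lambda>x. \<chi> i. c i * x $ i)"
      by (simp add: measurable_stretch measure_stretch matrix_def axis_def Determinants.det_diagonal)
  next
    fix m n :: 'n
    define h where "h = (\<lambda>x::real^'n. \<chi> i. x $ Transposition.transpose m n i)"
    have "linear h"
      by (rule linearI) (unfold Finite_Cartesian_Product.vec_eq_iff h_def, simp_all)
    \<comment> \<open>A swap is an involution, so its determinant squares to 1; this gives the
      absolute value without computing a sign.\<close>
    have hh: "h \<circ> h = id"
      unfolding fun_eq_iff Finite_Cartesian_Product.vec_eq_iff by (simp add: h_def)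
    have "matrix h ** matrix h = Finite_Cartesian_Product.mat 1"
      using matrix_compose[OF \<open>linear h\<close> \<open>linear h\<close>] by (simp add: hh matrix_id_mat_1)
    then have "Determinants.det (matrix h) * Determinants.det (matrix h) = 1"
      by (metis Determinants.det_I Determinants.det_mul)
    then have det: "\<bar>Determinants.det (matrix h)\<bar> = 1"
      by (auto simp: square_eq_1_iff)
    \<comment> \<open>By \<open>measure_linear_sufficient\<close> it is enough to scale boxes
      correctly. A swap only permutes the side lengths of a box; the factor 1 stands for the
      absolute determinant.\<close>
    have "measure lebesgue (h ` cbox a b) = 1 * measure lebesgue (cbox a b)" for a b
    proof -
      have inv: "h (h x) = x" for x
        using hh by (metis comp_apply id_apply)
      have box: "x \<in> cbox a b \<longleftrightarrow> h x \<in> cbox (h a) (h b)" for x a b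
        by (auto simp: mem_box_cart h_def) (metis transpose_involutory)+
      have "h ` cbox a b = cbox (h a) (h b)"
        using box inv by (auto simp: image_iff) metis
      moreover have "cbox (h a) (h b) = {} \<longleftrightarrow> cbox a b = {}"
        using calculation by (metis image_is_empty)
      moreover have "(\<Prod>i\<in>UNIV. h b $ i - h a $ i) = (\<Prod>i\<in>UNIV. b $ i - a $ i)"
        unfolding h_def vec_lambda_beta
        by (rule prod.permute[OF permutes_swap_id, of m UNIV n "\<lambda>i. b $ i - a $ i", unfolded o_def, symmetric]) auto
      ultimately show ?thesis
        by (simp only: measure_completion sets_lborel cbox_borel content_cbox_if_cart mult_1)
    qed
    from measure_linear_sufficient[OF \<open>linear h\<close> _ this] det show "?P h"
      by (metis mult_1)
  next
    fix m n :: 'n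
    assume "m \<noteq> n"
    define h where "h = (\<lambda>x::real^'n. \<chi> i. if i = m then x $ m + x $ n else x $ i)"
    have "linear h"
      by (rule linearI) (unfold Finite_Cartesian_Product.vec_eq_iff h_def, simp_all add: algebra_simps)
    have "measure lebesgue (h ` cbox a b) = 1 * measure lebesgue (cbox a b)" for a b
    proof (cases "cbox a b = {}")
      case False
      \<comment> \<open>\<open>measure_shear_interval\<close> wants a nonnegative lower bound in
        coordinate \<open>n\<close>. Translating by \<open>w\<close> makes that bound 0, and
        linearity turns this into a translation of the image by \<open>h w\<close>.\<close>
      define w where "w = (\<chi> i. if i = n then a $ n else 0)"
      let ?C = "cbox (a - w) (b - w)"
      have C: "cbox a b = (+) w ` ?C"
        by (simp add: cbox_translation[symmetric])
      then have "h ` cbox a b = (+) (h w) ` h ` ?C"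
        by (simp add: image_image linear_add[OF \<open>linear h\<close>])
      then have "measure lebesgue (h ` cbox a b) = measure lebesgue (h ` ?C)"
        by (simp add: measure_translation)
      also have "\<dots> = measure lebesgue ?C"
        unfolding h_def by (rule measure_shear_interval) (use \<open>m \<noteq> n\<close> False C in \<open>auto simp: w_def\<close>)
      also have "\<dots> = measure lebesgue (cbox a b)"
        unfolding C by (simp only: measure_translation)
      finally show ?thesis by simp
    qed simp
    moreover have "\<bar>Determinants.det (matrix h)\<bar> = 1"
      using det_matrix_shear[OF \<open>m \<noteq> n\<close>] by (simp only: h_def abs_1)
    ultimately show "?P h"
      using measure_linear_sufficient[OF \<open>linear h\<close>] by (metis mult_1)
  qed
  with \<open>S \<in> lmeasurable\<close> show ?thesis by blast
qed

text \<open>Subadditivity of volume: each covering set is a translated linear image of a ball of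
  radius \<open>r\<close>. The volume of the unit ball is a positive common factor and
  cancels.\<close>

lemma card_cover_ball_ge:
  fixes f :: "real^'n \<Rightarrow> real^'n"
  assumes "linear f" and "finite I" and "0 < L" and "0 \<le> r"
    and cover: "ball 0 L \<subseteq> (\<Union>i\<in>I. (\<lambda>y. c i + f y) ` cball (q i) r)"
  shows "L ^ CARD('n) \<le> real (card I) * \<bar>Determinants.det (matrix f)\<bar> * r ^ CARD('n)"
proof -
  let ?V = "measure lebesgue (ball (0::real^'n) 1)"
  let ?F = "\<lambda>i. (\<lambda>y. c i + f y) ` cball (q i) r"
  have F: "?F i = (+) (c i) ` f ` cball (q i) r" for i
    by auto
  have meas: "?F i \<in> lmeasurable" for i
    unfolding F using measure_linear_image_finite[OF \<open>linear f\<close>]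
    by (intro measurable_translation) simp
  have vol: "measure lebesgue (?F i) = \<bar>Determinants.det (matrix f)\<bar> * (r ^ CARD('n) * ?V)" for i
  proof -
    have "measure lebesgue (cball (q i) r) = r ^ CARD('n) * ?V"
      using content_ball_conv_unit_ball[of r "q i"] \<open>0 \<le> r\<close> by (simp add: content_cball_conv_ball)
    then show ?thesis
      unfolding F measure_translation using measure_linear_image_finite[OF \<open>linear f\<close>] by simp
  qed
  have "L ^ CARD('n) * ?V = measure lebesgue (ball (0::real^'n) L)"
    using content_ball_conv_unit_ball[of L "0::real^'n"] \<open>0 < L\<close> by simp
  also have "\<dots> \<le> measure lebesgue (\<Union>i\<in>I. ?F i)"
    by (rule measure_mono_fmeasurable[OF cover]) (use meas \<open>finite I\<close> in \<open>auto intro: fmeasurable.finite_UN\<close>)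
  also have "\<dots> \<le> (\<Sum>i\<in>I. measure lebesgue (?F i))"
    by (rule measure_UNION_le[OF \<open>finite I\<close>]) (use meas in blast)
  also have "\<dots> = real (card I) * \<bar>Determinants.det (matrix f)\<bar> * r ^ CARD('n) * ?V"
    by (simp add: vol)
  finally show ?thesis
    using content_ball_pos[of 1 "0::real^'n"] by simp
qed

section \<open>The matrix exponential and homogeneous linear equations\<close>

definition matrix_power :: "real^'n^'n \<Rightarrow> nat \<Rightarrow> real^'n^'n" where
  "matrix_power A k = (((**) A) ^^ k) (Finite_Cartesian_Product.mat 1)"

text \<open>This is exp(tA), written entrywise as a scalar power series in \<open>t\<close> so that
  termwise differentiation applies to each entry.\<close>

definition matrix_exp :: "real^'n^'n \<Rightarrow> real \<Rightarrow> real^'n^'n" where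
  "matrix_exp A t = (\<chi> i j. \<Sum>k. matrix_power A k $ i $ j / fact k * t ^ k)"

lemma matrix_power_0 [simp]: "matrix_power A 0 = Finite_Cartesian_Product.mat 1"
  by (simp add: matrix_power_def)

lemma matrix_power_Suc: "matrix_power A (Suc k) = A ** matrix_power A k"
  by (simp add: matrix_power_def)

lemma matrix_power_Suc2: "matrix_power A (Suc k) = matrix_power A k ** A"
proof (induction k)
  case (Suc k)
  have "matrix_power A (Suc (Suc k)) = A ** (matrix_power A k ** A)"
    by (simp only: matrix_power_Suc[of A "Suc k"] Suc.IH)
  also have "\<dots> = matrix_power A (Suc k) ** A"
    by (simp only: matrix_mul_assoc matrix_power_Suc)
  finally show ?case .
qed (simp add: matrix_power_Suc)

lemma summable_matrix_exp:
  fixes A :: "real^'n^'n"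
  shows "summable (\<lambda>k. matrix_power A k $ i $ j / fact k * t ^ k)"
proof -
  \<comment> \<open>\<open>C\<close> dominates every absolute row sum, so the entries of the
    \<open>k\<close>-th power are bounded by \<open>C ^ k\<close> and the series by that of exp(C
    |t|).\<close>
  define C where "C = (\<Sum>i\<in>UNIV. \<Sum>l\<in>UNIV. \<bar>A $ i $ l\<bar>)"
  have "0 \<le> C"
    unfolding C_def by (intro sum_nonneg) auto
  have bound: "\<bar>matrix_power A k $ i $ j\<bar> \<le> C ^ k" for k i j
  proof (induction k arbitrary: i)
    case (Suc k)
    have "\<bar>matrix_power A (Suc k) $ i $ j\<bar> \<le> (\<Sum>l\<in>UNIV. \<bar>A $ i $ l\<bar> * \<bar>matrix_power A k $ l $ j\<bar>)"
      unfolding matrix_power_Suc matrix_matrix_mult_def by (simp flip: abs_mult)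
    also have "\<dots> \<le> (\<Sum>l\<in>UNIV. \<bar>A $ i $ l\<bar> * C ^ k)"
      by (intro sum_mono mult_left_mono Suc.IH) auto
    also have "\<dots> = (\<Sum>l\<in>UNIV. \<bar>A $ i $ l\<bar>) * C ^ k"
      by (simp add: sum_distrib_right)
    also have "\<dots> \<le> C * C ^ k"
      unfolding C_def
      by (intro mult_right_mono member_le_sum[where f = "\<lambda>i. \<Sum>l\<in>UNIV. \<bar>A $ i $ l\<bar>"])
         (auto intro!: sum_nonneg zero_le_power)
    finally show ?case by simp
  qed (simp add: Finite_Cartesian_Product.mat_def)
  have "norm (matrix_power A k $ i $ j / fact k * t ^ k) \<le> inverse (fact k) * (C * \<bar>t\<bar>) ^ k" for k
    using mult_right_mono[OF bound[of k i j], of "\<bar>t\<bar> ^ k"]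
    by (simp add: abs_mult power_abs power_mult_distrib field_simps)
  then show ?thesis
    by (rule summable_comparison_test'[OF summable_exp[of "C * \<bar>t\<bar>"]])
qed

text \<open>The factor \<open>A\<close> is kept on the right, where it will meet a vector
  \<open>A *v d s\<close> in the product rule.\<close>

lemma has_field_derivative_matrix_exp:
  fixes A :: "real^'n^'n"
  shows "((\<lambda>t. matrix_exp A t $ i $ j) has_field_derivative (matrix_exp A t ** A) $ i $ j) (at t)"
proof -
  let ?c = "\<lambda>k. matrix_power A k $ i $ j / fact k"
  have "(\<Sum>k. diffs ?c k * t ^ k)
      = (\<Sum>k. \<Sum>l\<in>UNIV. matrix_power A k $ i $ l / fact k * t ^ k * A $ l $ j)"
  proof (rule suminf_cong)
    fix k
    \<comment> \<open>\<open>diffs\<close> shifts the coefficients by one, and (k+1)/(k+1)! =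
      1/k!.\<close>
    have "diffs ?c k = matrix_power A (Suc k) $ i $ j / fact k"
      by (simp add: diffs_def field_simps del: of_nat_Suc)
    then show "diffs ?c k * t ^ k
        = (\<Sum>l\<in>UNIV. matrix_power A k $ i $ l / fact k * t ^ k * A $ l $ j)"
      by (simp add: matrix_power_Suc2 matrix_matrix_mult_def sum_distrib_left sum_divide_distrib mult_ac)
  qed
  also have "\<dots> = (\<Sum>l\<in>UNIV. \<Sum>k. matrix_power A k $ i $ l / fact k * t ^ k * A $ l $ j)"
    by (intro suminf_sum summable_mult2 summable_matrix_exp)
  also have "\<dots> = (matrix_exp A t ** A) $ i $ j"
    by (simp only: matrix_matrix_mult_def matrix_exp_def vec_lambda_beta suminf_mult2[OF summable_matrix_exp])
  finally have eq: "(\<Sum>k. diffs ?c k * t ^ k) = (matrix_exp A t ** A) $ i $ j" .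
  have "((\<lambda>t. matrix_exp A t $ i $ j) has_field_derivative (\<Sum>k. diffs ?c k * t ^ k)) (at t)"
    using termdiffs_strong_converges_everywhere[OF summable_matrix_exp[of A i j]]
    by (simp add: matrix_exp_def)
  then show ?thesis by (simp only: eq)
qed

lemma matrix_exp_0 [simp]: "matrix_exp A 0 = Finite_Cartesian_Product.mat 1"
proof -
  have "(\<Sum>k. matrix_power A k $ i $ j / fact k * 0 ^ k) = Finite_Cartesian_Product.mat 1 $ i $ j" for i j
    using powser_zero[of "\<lambda>k. matrix_power A k $ i $ j / fact k"] by simp
  then show ?thesis
    by (simp only: matrix_exp_def) (simp add: Finite_Cartesian_Product.vec_eq_iff)
qed

text \<open>Triangularity passes to powers, whose diagonal entries are powers of those of
  \<open>A\<close>. Hence the exponential is triangular with diagonal entries exp(t a_ii), and their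
  product is the exponential of a sum.\<close>

lemma det_matrix_exp_triangular:
  fixes A :: "real^'n^'n" and idx :: "'n \<Rightarrow> nat"
  assumes inj: "inj idx" and tri: "\<And>i j. idx j < idx i \<Longrightarrow> A $ i $ j = 0"
  shows "Determinants.det (matrix_exp A t) = exp (t * trace A)"
proof -
  have tri_power: "matrix_power A k $ i $ j = 0" if "idx j < idx i" for k i j
    using that
  proof (induction k arbitrary: i)
    case 0
    then show ?case by (auto simp: Finite_Cartesian_Product.mat_def)
  next
    case (Suc k)
    \<comment> \<open>Either \<open>l\<close> comes before \<open>i\<close> and the first factor
      vanishes, or \<open>l\<close> comes after \<open>j\<close> and the second one does.\<close>
    have "A $ i $ l * matrix_power A k $ l $ j = 0" for l
      using tri[of l i] Suc.IH[of l] Suc.prems by (cases "idx l < idx i") auto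
    then show ?case
      unfolding matrix_power_Suc matrix_matrix_mult_def by (simp only: vec_lambda_beta sum.neutral_const)
  qed
  have diag_power: "matrix_power A k $ i $ i = (A $ i $ i) ^ k" for k i
  proof (induction k)
    case (Suc k)
    have "A $ i $ l * matrix_power A k $ l $ i = (if l = i then A $ i $ i ^ Suc k else 0)" for l
      using tri[of l i] tri_power[of i l k] Suc.IH inj by (cases "idx l" "idx i" rule: linorder_cases) (auto dest: injD)
    then show ?case by (simp add: matrix_power_Suc matrix_matrix_mult_def)
  qed (simp add: Finite_Cartesian_Product.mat_def)
  have "matrix_exp A t $ i $ i = exp (t * A $ i $ i)" for i
    by (simp add: matrix_exp_def diag_power exp_def power_mult_distrib field_simps)
  moreover have "matrix_exp A t $ i $ j = 0" if "idx j < idx i" for i j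
    by (simp add: matrix_exp_def tri_power[OF that])
  ultimately have "Determinants.det (matrix_exp A t) = (\<Prod>i\<in>UNIV. exp (t * A $ i $ i))"
    using det_triangular[OF inj, of "matrix_exp A t"] by simp
  then show ?thesis
    by (simp add: exp_sum trace_def sum_distrib_left)
qed

text \<open>The function exp(-sA) d(s) has derivative 0 along a solution of d' = Ad, so its values
  at 0 and \<open>t\<close> agree.\<close>

lemma matrix_exp_backward:
  fixes A :: "real^'n^'n" and d :: "real \<Rightarrow> real^'n"
  assumes "0 \<le> t"
    and sol: "\<And>\<tau>. \<tau> \<in> {0..t} \<Longrightarrow> ((\<lambda>s. A *v d s) has_integral (d \<tau> - d 0)) {0..\<tau>}"
  shows "matrix_exp A (- t) *v d t = d 0"
proof -
  \<comment> \<open>Regularity is bootstrapped from the integral form: an indefinite integral is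
    continuous, so \<open>d\<close> and the integrand are continuous, and then \<open>d\<close> is
    differentiable.\<close>
  have d_eq: "d \<tau> = d 0 + integral {0..\<tau>} (\<lambda>s. A *v d s)" if "\<tau> \<in> {0..t}" for \<tau>
    using integral_unique[OF sol[OF that]] by simp
  have "(\<lambda>s. A *v d s) integrable_on {0..t}"
    by (rule has_integral_integrable[OF sol]) (use \<open>0 \<le> t\<close> in simp)
  then have "continuous_on {0..t} (\<lambda>\<tau>. d 0 + integral {0..\<tau>} (\<lambda>s. A *v d s))"
    by (intro continuous_on_add continuous_on_const indefinite_integral_continuous_1)
  then have cont: "continuous_on {0..t} d"
    by (rule continuous_on_eq) (rule d_eq[symmetric])
  have deriv: "(d has_vector_derivative A *v d s) (at s within {0..t})" if "s \<in> {0..t}" for s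
  proof -
    have "continuous_on {0..t} (\<lambda>s. A *v d s)"
      by (rule continuous_on_compose2[OF _ cont, of UNIV]) (auto intro: matrix_vector_mult_linear_continuous_on)
    from has_vector_derivative_add[OF has_vector_derivative_const[of "d 0"]
        integral_has_vector_derivative[OF this that]]
    have "((\<lambda>\<tau>. d 0 + integral {0..\<tau>} (\<lambda>s. A *v d s)) has_vector_derivative A *v d s) (at s within {0..t})"
      by (simp only: add_0)
    then show ?thesis
      by (rule has_vector_derivative_transform[OF that, rotated]) (rule d_eq)
  qed
  have "matrix_exp A (- t) *v d t = matrix_exp A (- 0) *v d 0"
  proof (subst Finite_Cartesian_Product.vec_eq_iff, intro allI)
    fix i
    let ?w = "\<lambda>s. \<Sum>j\<in>UNIV. matrix_exp A (- s) $ i $ j * d s $ j"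
    have "(?w has_vector_derivative 0) (at s within {0..t})" if s: "s \<in> {0..t}" for s
    proof -
      have E: "((\<lambda>s. matrix_exp A (- s) $ i $ j) has_field_derivative - ((matrix_exp A (- s) ** A) $ i $ j))
          (at s within {0..t})" for j
      proof -
        have "((\<lambda>s. matrix_exp A (- s) $ i $ j) has_field_derivative (matrix_exp A (- s) ** A) $ i $ j * (- 1))
            (at s within {0..t})"
          by (rule DERIV_chain2[where f = "\<lambda>s. matrix_exp A s $ i $ j"])
             (rule has_field_derivative_matrix_exp, auto intro!: derivative_eq_intros)
        then show ?thesis by simp
      qed
      have D: "((\<lambda>s. d s $ j) has_field_derivative (A *v d s) $ j) (at s within {0..t})" for j
        using bounded_linear.has_vector_derivative[OF bounded_linear_vec_nth deriv[OF s]]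
        by (simp add: has_real_derivative_iff_has_vector_derivative)
      \<comment> \<open>In the product rule the two terms cancel by associativity: exp(-sA) (A d) =
        (exp(-sA) A) d.\<close>
      have "(?w has_field_derivative
          (\<Sum>j\<in>UNIV. matrix_exp A (- s) $ i $ j * (A *v d s) $ j
            + - ((matrix_exp A (- s) ** A) $ i $ j) * d s $ j)) (at s within {0..t})"
        by (intro DERIV_sum DERIV_mult' E D)
      also have "(\<Sum>j\<in>UNIV. matrix_exp A (- s) $ i $ j * (A *v d s) $ j
            + - ((matrix_exp A (- s) ** A) $ i $ j) * d s $ j)
          = (matrix_exp A (- s) *v (A *v d s)) $ i - ((matrix_exp A (- s) ** A) *v d s) $ i"
        by (simp add: matrix_vector_mult_def sum_subtractf)
      also have "\<dots> = 0"
        by (simp add: matrix_vector_mul_assoc)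
      finally show ?thesis
        by (simp add: has_real_derivative_iff_has_vector_derivative)
    qed
    then have "\<exists>c. \<forall>s\<in>{0..t}. ?w s = c"
      by (intro has_derivative_zero_constant) (auto simp: has_vector_derivative_def)
    then have "?w t = ?w 0"
      using \<open>0 \<le> t\<close> by force
    then show "(matrix_exp A (- t) *v d t) $ i = (matrix_exp A (- 0) *v d 0) $ i"
      by (simp add: matrix_vector_mult_def)
  qed
  then show ?thesis by simp
qed

section \<open>The bound at a fixed time\<close>

text \<open>The map \<open>g\<close> serves both claims: the identity for estimation, the constant 0
  for stabilization. In either case the alternative alone determines the centre of the ball
  containing the state.\<close>

lemma received_bits_lower_bound:
  fixes A :: "real ^ 'n ^ 'n" and B :: "real ^ 'm ^ 'n"
    and R :: "real ^ 'n \<Rightarrow> ('n::finite, 'm::finite) run"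
    and g :: "real ^ 'n \<Rightarrow> real ^ 'n"
  assumes jordan: "in_real_jordan_form A" and "0 < L"
    and loop: "closed_loop A B L \<gamma> R" and bits: "received_bits L R bc"
    and "0 \<le> t" and "0 < r"
    and accuracy: "\<And>x0. x0 \<in> ball 0 L \<Longrightarrow> norm (state (R x0) t - g (estimate (R x0) t)) \<le> r"
  shows "ereal (t * trace A / ln 2 + real CARD('n) * log 2 (L / r)) \<le> bc t"
proof (cases "bc t = \<infinity>")
  case False
  define b where "b = real_of_ereal (bc t)"
  have "0 \<le> bc t" "bc t < \<infinity>"
    using bits \<open>0 \<le> t\<close> False by (auto simp: received_bits_def)
  then have b: "bc t = ereal b"
    unfolding b_def by (cases "bc t") auto
  have fin: "finite (alternatives L R t)" and card: "real (card (alternatives L R t)) \<le> 2 powr b"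
    using bits \<open>0 \<le> t\<close> \<open>bc t < \<infinity>\<close> by (auto simp: received_bits_def b_def)
  define alt where "alt x0 = (restrict (control (R x0)) {0..t}, estimate (R x0) t)" for x0
  have alts: "alternatives L R t = alt ` ball 0 L"
    by (simp add: alternatives_def alt_def)
  \<comment> \<open>One representative initial condition for each alternative.\<close>
  define rep where "rep = inv_into (ball 0 L) alt"
  define \<Psi> where "\<Psi> = matrix_exp A (- t)"

  \<comment> \<open>Equal alternatives mean equal inputs on [0,t], so the \<open>B\<close> terms
    cancel in the difference of the two trajectories, and \<open>matrix_exp_backward\<close> carries
    the difference at \<open>t\<close> back to time 0.\<close>
  have recover: "x = y + \<Psi> *v (state (R x) t - state (R y) t)"
    if x: "x \<in> ball 0 L" and y: "y \<in> ball 0 L" and eq: "alt x = alt y" for x y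
  proof -
    let ?d = "\<lambda>s. state (R x) s - state (R y) s"
    have traj: "plant_trajectory A B (control (R x)) x (state (R x))"
      "plant_trajectory A B (control (R y)) y (state (R y))"
      using loop x y by (auto simp: closed_loop_def)
    have control: "control (R x) s = control (R y) s" if "s \<in> {0..t}" for s
      using eq that unfolding alt_def by (metis prod.inject restrict_apply')
    have d0: "?d 0 = x - y"
      using traj by (simp add: plant_trajectory_def)
    have "((\<lambda>s. A *v ?d s) has_integral (?d \<tau> - ?d 0)) {0..\<tau>}" if \<tau>: "\<tau> \<in> {0..t}" for \<tau>
    proof -
      have "((\<lambda>s. (A *v state (R x) s + B *v control (R x) s) - (A *v state (R y) s + B *v control (R y) s))
          has_integral ((state (R x) \<tau> - x) - (state (R y) \<tau> - y))) {0..\<tau>}"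
        using traj \<tau> by (intro has_integral_diff) (auto simp: plant_trajectory_def)
      moreover have "(A *v state (R x) s + B *v control (R x) s) - (A *v state (R y) s + B *v control (R y) s)
          = A *v ?d s" if "s \<in> {0..\<tau>}" for s
        using control[of s] that \<tau> by (simp add: matrix_vector_mult_diff_distrib)
      ultimately have "((\<lambda>s. A *v ?d s) has_integral ((state (R x) \<tau> - x) - (state (R y) \<tau> - y))) {0..\<tau>}"
        by (rule has_integral_eq[rotated])
      then show ?thesis
        unfolding d0 by (simp add: algebra_simps)
    qed
    from matrix_exp_backward[OF \<open>0 \<le> t\<close> this] show ?thesis
      unfolding d0 \<Psi>_def by simp
  qed

  \<comment> \<open>\<open>recover\<close> with \<open>y = rep a\<close> has been split into a part
    depending only on \<open>a\<close> and the image under \<open>\<Psi>\<close> of the state at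
    \<open>t\<close>.\<close>
  have cover: "ball 0 L \<subseteq> (\<Union>a\<in>alternatives L R t.
      (\<lambda>y. (rep a - \<Psi> *v state (R (rep a)) t) + \<Psi> *v y) ` cball (g (snd a)) r)"
  proof
    fix x :: "real^'n"
    assume x: "x \<in> ball 0 L"
    let ?a = "alt x"
    have a: "?a \<in> alternatives L R t"
      using x by (simp add: alts)
    then have "rep ?a \<in> ball 0 L" "alt (rep ?a) = ?a"
      unfolding rep_def alts by (rule inv_into_into, rule f_inv_into_f)
    then have "x = rep ?a + \<Psi> *v (state (R x) t - state (R (rep ?a)) t)"
      by (intro recover x) simp_all
    also have "\<dots> = (rep ?a - \<Psi> *v state (R (rep ?a)) t) + \<Psi> *v state (R x) t"
      by (simp add: matrix_vector_mult_diff_distrib)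
    finally have "x = (rep ?a - \<Psi> *v state (R (rep ?a)) t) + \<Psi> *v state (R x) t" .
    moreover have "state (R x) t \<in> cball (g (snd ?a)) r"
      using accuracy[OF x] by (simp add: alt_def dist_norm norm_minus_commute)
    ultimately show "x \<in> (\<Union>a\<in>alternatives L R t.
      (\<lambda>y. (rep a - \<Psi> *v state (R (rep a)) t) + \<Psi> *v y) ` cball (g (snd a)) r)"
      using a by blast
  qed

  obtain idx :: "'n \<Rightarrow> nat" and blocks where idx: "bij_betw idx UNIV {..<CARD('n)}"
    and size: "sum_list (map fst blocks) = CARD('n)"
    and A: "\<And>i j. A $ i $ j = jordan_matrix blocks $$ (idx i, idx j)"
    using jordan by (auto simp: in_real_jordan_form_def)
  have "A $ i $ j = 0" if "idx j < idx i" for i j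
    unfolding A by (rule jordan_matrix_upper_triangular) (use idx size that in \<open>auto dest: bij_betwE\<close>)
  then have det: "Determinants.det \<Psi> = exp (- (t * trace A))"
    using det_matrix_exp_triangular[OF bij_betw_imp_inj_on[OF idx], of A "- t"] by (simp add: \<Psi>_def)
  have "L ^ CARD('n) \<le> real (card (alternatives L R t)) * exp (- (t * trace A)) * r ^ CARD('n)"
    using card_cover_ball_ge[OF matrix_vector_mul_linear fin \<open>0 < L\<close> _ cover] \<open>0 < r\<close>
    by (simp add: matrix_of_matrix_vector_mul det)
  also have "\<dots> \<le> 2 powr b * exp (- (t * trace A)) * r ^ CARD('n)"
    using card \<open>0 < r\<close> by (intro mult_right_mono) auto
  finally have "exp (t * trace A) * (L / r) ^ CARD('n) \<le> 2 powr b"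
    using \<open>0 < r\<close> by (simp add: field_simps exp_minus)
  then have "log 2 (exp (t * trace A) * (L / r) ^ CARD('n)) \<le> b"
    using \<open>0 < L\<close> \<open>0 < r\<close> by (subst log_le_iff) auto
  moreover have "log 2 (exp (t * trace A) * (L / r) ^ CARD('n))
      = t * trace A / ln 2 + real CARD('n) * log 2 (L / r)"
    using \<open>0 < L\<close> \<open>0 < r\<close> by (simp add: log_mult_pos log_nat_power)
  ultimately show ?thesis
    by (simp add: b)
qed simp

section \<open>The access rate and the necessary conditions\<close>

text \<open>After division by \<open>t\<close> the constant \<open>d\<close> contributes
  \<open>d / t\<close>, which tends to 0.\<close>

lemma information_access_rate_ge:
  assumes "\<And>t. 0 \<le> t \<Longrightarrow> ereal (t * c + d) \<le> b t"
  shows "ereal c \<le> information_access_rate b"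
proof -
  have "((\<lambda>t. c + d / t) \<longlongrightarrow> c + 0) at_top"
    by (intro tendsto_intros tendsto_divide_0[OF tendsto_const] filterlim_at_top_imp_at_infinity filterlim_ident)
  then have "Limsup at_top (\<lambda>t. ereal (c + d / t)) = ereal c"
    by (intro lim_imp_Limsup) (auto simp: tendsto_ereal)
  moreover have "Limsup at_top (\<lambda>t. ereal (c + d / t)) \<le> information_access_rate b"
    unfolding information_access_rate_def
  proof (rule Limsup_mono)
    show "\<forall>\<^sub>F t in at_top. ereal (c + d / t) \<le> b t / ereal t"
      using eventually_gt_at_top[of 0]
    proof eventually_elim
      case (elim t)
      then have "ereal (c + d / t) = ereal (t * c + d) / ereal t"
        by (simp add: field_simps)
      also have "\<dots> \<le> b t / ereal t"
        using assms[of t] elim by (intro ereal_divide_right_mono) auto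
      finally show ?case .
    qed
  qed
  ultimately show ?thesis by simp
qed

theorem theorem5:
  fixes A :: "real ^ 'n ^ 'n" and B :: "real ^ 'm ^ 'n"
    and L \<gamma> \<sigma> :: real
    and R :: "real ^ 'n \<Rightarrow> ('n::finite, 'm::finite) run"
    and bc :: "real \<Rightarrow> ereal"
  assumes "\<forall>l. complex_eigenvalue A l \<longrightarrow> l \<in> \<real> \<and> 0 < Re l"
    and "in_real_jordan_form A"
    and "0 < L" and "0 \<le> \<gamma>" and "0 < \<sigma>"
    and "closed_loop A B L \<gamma> R"
    and "received_bits L R bc"
  shows
    \<comment> \<open>(i); z0 is the given positive number to which the norm of z(0) is bounded\<close>
    "(\<forall>z0>0.
        (\<forall>x0 \<in> ball 0 L. \<forall>t\<ge>0.
           norm (estimation_error (R x0) t) \<le> z0 * exp (- \<sigma> * t)) \<longrightarrow>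
        (\<forall>t\<ge>0. bc t \<ge> ereal (t * ((trace A + real CARD('n) * \<sigma>) / ln 2)
                                + real CARD('n) * log 2 (L / z0))) \<and>
        information_access_rate bc \<ge> ereal ((trace A + real CARD('n) * \<sigma>) / ln 2)) \<and>
     \<comment> \<open>(ii)\<close>
     (stabilizable A B \<and>
      (\<forall>x0 \<in> ball 0 L. \<forall>t\<ge>0. norm (state (R x0) t) \<le> norm x0 * exp (- \<sigma> * t)) \<longrightarrow>
        (\<forall>t\<ge>0. bc t \<ge> ereal (t * ((trace A + real CARD('n) * \<sigma>) / ln 2))) \<and>
        information_access_rate bc \<ge> ereal ((trace A + real CARD('n) * \<sigma>) / ln 2)) \<and>
     \<comment> \<open>(ii) with the accuracy read as in (i), L being the given bound on the norm of x(0)\<close>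
     (stabilizable A B \<and>
      (\<forall>x0 \<in> ball 0 L. \<forall>t\<ge>0. norm (state (R x0) t) \<le> L * exp (- \<sigma> * t)) \<longrightarrow>
        (\<forall>t\<ge>0. bc t \<ge> ereal (t * ((trace A + real CARD('n) * \<sigma>) / ln 2))) \<and>
        information_access_rate bc \<ge> ereal ((trace A + real CARD('n) * \<sigma>) / ln 2))"
proof -
  let ?c = "(trace A + real CARD('n) * \<sigma>) / ln 2"
  \<comment> \<open>With radius \<open>z * exp (- \<sigma> * t)\<close>, the logarithm of L/r splits
    into that of L/z and \<open>\<sigma> * t / ln 2\<close>; the latter, taken \<open>n\<close>
    times, joins the trace term.\<close>
  have bound: "ereal (t * ?c + real CARD('n) * log 2 (L / z)) \<le> bc t"
    if "0 \<le> t" "0 < z"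
      and acc: "\<And>x0. x0 \<in> ball 0 L \<Longrightarrow>
        norm (state (R x0) t - g (estimate (R x0) t)) \<le> z * exp (- \<sigma> * t)" for t z g
  proof -
    have "L / (z * exp (- \<sigma> * t)) = L / z * exp (\<sigma> * t)"
      by (simp add: exp_minus field_simps)
    then have "log 2 (L / (z * exp (- \<sigma> * t))) = log 2 (L / z) + \<sigma> * t / ln 2"
      using \<open>0 < L\<close> \<open>0 < z\<close> by (simp only: log_mult_pos divide_pos_pos exp_gt_zero) (simp add: log_def)
    then have "t * trace A / ln 2 + real CARD('n) * log 2 (L / (z * exp (- \<sigma> * t)))
        = t * ?c + real CARD('n) * log 2 (L / z)"
      by (simp add: field_simps)
    then show ?thesis
      using received_bits_lower_bound[OF assms(2,3,6,7) \<open>0 \<le> t\<close> _ acc] \<open>0 < z\<close> by simp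
  qed
  have rate: "ereal ?c \<le> information_access_rate bc"
    if "\<And>t. 0 \<le> t \<Longrightarrow> ereal (t * ?c + d) \<le> bc t" for d
    using that by (rule information_access_rate_ge)
  have estimation: "(\<forall>t\<ge>0. ereal (t * ?c + real CARD('n) * log 2 (L / z0)) \<le> bc t) \<and>
      ereal ?c \<le> information_access_rate bc"
    if "0 < z0" "\<forall>x0 \<in> ball 0 L. \<forall>t\<ge>0. norm (estimation_error (R x0) t) \<le> z0 * exp (- \<sigma> * t)" for z0
    using bound[where g = "\<lambda>x. x" and z = z0] rate[of "real CARD('n) * log 2 (L / z0)"] that
    by (simp add: estimation_error_def)
  \<comment> \<open>The ball is centred at the origin whatever the estimate is, and
    \<open>z = L\<close> makes the constant term log(L/L) = 0.\<close>
  have stabilization: "(\<forall>t\<ge>0. ereal (t * ?c) \<le> bc t) \<and> ereal ?c \<le> information_access_rate bc"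
    if "\<forall>x0 \<in> ball 0 L. \<forall>t\<ge>0. norm (state (R x0) t) \<le> L * exp (- \<sigma> * t)"
    using bound[where g = "\<lambda>_. 0" and z = L] rate[of 0] that \<open>0 < L\<close> by simp
  \<comment> \<open>Since the norm of \<open>x0\<close> is below \<open>L\<close>, decay relative to
    \<open>x0\<close> implies decay relative to \<open>L\<close>, so the first form of (ii) follows
    from the second.\<close>
  have "norm (state (R x0) t) \<le> L * exp (- \<sigma> * t)"
    if "norm (state (R x0) t) \<le> norm x0 * exp (- \<sigma> * t)" "x0 \<in> ball 0 L" for x0 t
    using that by (smt (verit) exp_gt_zero mem_ball_0 mult_right_mono)
  with estimation stabilization show ?thesis by blast
qed

end
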